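(* Let $0<\alpha<1$ and let $b>0$ be real. Let $L:[0,b]\times\mathbb{R}\times\mathbb{R}\to\mathbb{R}$, and assume that the functional $J:C^2[0,b]\to\mathbb{R}$ of the form $$J(f)=\int_0^b L\big(t,f(t),({}^{ABC}D_b^\alpha f)(t)\big)\,dt$$ has a local extremum in $S=\{y\in C^2[0,b]: y(0)=A,\ y(b)=C\}$ (where $A,C\in\mathbb{R}$ are given) at some $f\in S$. Then $$L_1(s)+({}^{ABR}{}_{0}D^\alpha L_2)(s)=0\qquad\text{for all } s\in[0,b],$$ where $L_1(s)$ and $L_2(s)$ denote the partial derivatives of $L$ with respect to its second and third arguments, respectively, evaluated at $\big(s,f(s),({}^{ABC}D_b^\alpha f)(s)\big)$.
   Context: $B(\alpha)>0$ is a normalization constant depending on $\alpha$, and $E_\alpha(z)=\sum_{k\ge0}\frac{z^k}{\Gamma(\alpha k+1)}$ is the Mittag-Leffler function. The right Caputo-type and left Riemann-Liouville-type fractional derivatives with Mittag-Leffler kernel are $$({}^{ABC}D_b^\alpha f)(t)=-\frac{B(\alpha)}{1-\alpha}\int_t^b f'(x)\,E_\alpha\!\left[-\alpha\frac{(x-t)^\alpha}{1-\alpha}\right]dx,$$ $$({}^{ABR}{}_{0}D^\alpha f)(t)=\frac{B(\alpha)}{1-\alpha}\frac{d}{dt}\int_0^t f(x)\,E_\alpha\!\left[-\alpha\frac{(t-x)^\alpha}{1-\alpha}\right]dx,$$ with one-sided derivatives at the endpoints. $J$ has a local maximum in $S$ at $f$ if there is $\epsilon>0$ such that $J(\widehat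 f)\le J(f)$ for all $\widehat f\in S$ with $\|\widehat f-f\|=\sup_{t\in[0,b]}|\widehat f(t)-f(t)|<\epsilon$; a local minimum is defined with the reverse inequality, and a local extremum is a local maximum or minimum. The partial derivatives of $L$ with respect to its second and third arguments are understood to exist.
   Formalization: The partial derivatives of L in its second and third arguments are assumed jointly continuous on [0,b]×ℝ×ℝ, not merely to exist; otherwise the claim fails (L(t,y,z)=y at t=t0, and 0 elsewhere). *)

theory Defs
  imports "HOL-Analysis.Analysis"
begin

text \<open>
  Functions on \<open>[0,b]\<close> are represented by functions of type \<open>real \<Rightarrow> real\<close>; their values outside
  \<open>{0..b}\<close> never matter. All derivatives on \<open>[0,b]\<close> are taken within \<open>{0..b}\<close>, so they
  are one-sided at the endpoints.
\<close>

definition C2_on :: "real \<Rightarrow> (real \<Rightarrow> real) set" where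
  "C2_on b = {f. \<exists>f' f''.
     (\<forall>t\<in>{0..b}. (f has_real_derivative f' t) (at t within {0..b})) \<and>
     (\<forall>t\<in>{0..b}. (f' has_real_derivative f'' t) (at t within {0..b})) \<and>
     continuous_on {0..b} f''}"

definition mittag_leffler :: "real \<Rightarrow> real \<Rightarrow> real" where
  "mittag_leffler \<alpha> z = (\<Sum>k. z ^ k / Gamma (\<alpha> * real k + 1))"

definition ml_kernel :: "real \<Rightarrow> real \<Rightarrow> real" where
  "ml_kernel \<alpha> u = mittag_leffler \<alpha> (- \<alpha> * (u powr \<alpha> / (1 - \<alpha>)))"

definition ABC_right :: "(real \<Rightarrow> real) \<Rightarrow> real \<Rightarrow> real \<Rightarrow> (real \<Rightarrow> real) \<Rightarrow> real \<Rightarrow> real" where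
  "ABC_right B \<alpha> b f t =
     - (B \<alpha> / (1 - \<alpha>)) *
       integral {t..b} (\<lambda>x. vector_derivative f (at x within {0..b}) * ml_kernel \<alpha> (x - t))"

definition ABR_integral :: "real \<Rightarrow> (real \<Rightarrow> real) \<Rightarrow> real \<Rightarrow> real" where
  "ABR_integral \<alpha> g t = integral {0..t} (\<lambda>x. g x * ml_kernel \<alpha> (t - x))"

text \<open>
  \<open>ABR_left\<close> is meaningful at \<open>t\<close> only if \<open>ABR_integral \<alpha> g\<close> is differentiable at \<open>t\<close> within
  \<open>{0..b}\<close>; \<open>vector_derivative\<close> is unspecified otherwise.
\<close>

definition ABR_left :: "(real \<Rightarrow> real) \<Rightarrow> real \<Rightarrow> real \<Rightarrow> (real \<Rightarrow> real) \<Rightarrow> real \<Rightarrow> real" where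
  "ABR_left B \<alpha> b g t =
     B \<alpha> / (1 - \<alpha>) * vector_derivative (ABR_integral \<alpha> g) (at t within {0..b})"

definition local_max_in ::
    "real \<Rightarrow> (real \<Rightarrow> real) set \<Rightarrow> ((real \<Rightarrow> real) \<Rightarrow> real) \<Rightarrow> (real \<Rightarrow> real) \<Rightarrow> bool" where
  "local_max_in b S J f \<longleftrightarrow>
     (\<exists>\<epsilon>>0. \<forall>g\<in>S. (SUP t\<in>{0..b}. \<bar>g t - f t\<bar>) < \<epsilon> \<longrightarrow> J g \<le> J f)"

definition local_min_in ::
    "real \<Rightarrow> (real \<Rightarrow> real) set \<Rightarrow> ((real \<Rightarrow> real) \<Rightarrow> real) \<Rightarrow> (real \<Rightarrow> real) \<Rightarrow> bool" where
  "local_min_in b S J f \<longleftrightarrow>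
     (\<exists>\<epsilon>>0. \<forall>g\<in>S. (SUP t\<in>{0..b}. \<bar>g t - f t\<bar>) < \<epsilon> \<longrightarrow> J g \<ge> J f)"

definition local_extremum_in ::
    "real \<Rightarrow> (real \<Rightarrow> real) set \<Rightarrow> ((real \<Rightarrow> real) \<Rightarrow> real) \<Rightarrow> (real \<Rightarrow> real) \<Rightarrow> bool" where
  "local_extremum_in b S J f \<longleftrightarrow> local_max_in b S J f \<or> local_min_in b S J f"

definition admissible :: "real \<Rightarrow> real \<Rightarrow> real \<Rightarrow> (real \<Rightarrow> real) set" where
  "admissible b A C = {y \<in> C2_on b. y 0 = A \<and> y b = C}"

definition lagrangian_along ::
    "(real \<Rightarrow> real) \<Rightarrow> real \<Rightarrow> real \<Rightarrow> (real \<Rightarrow> real \<Rightarrow> real \<Rightarrow> real) \<Rightarrow> (real \<Rightarrow> real) \<Rightarrow> real \<Rightarrow> real" where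
  "lagrangian_along B \<alpha> b L f t = L t (f t) (ABC_right B \<alpha> b f t)"

definition action_functional ::
    "(real \<Rightarrow> real) \<Rightarrow> real \<Rightarrow> real \<Rightarrow> (real \<Rightarrow> real \<Rightarrow> real \<Rightarrow> real) \<Rightarrow> (real \<Rightarrow> real) \<Rightarrow> real" where
  "action_functional B \<alpha> b L f = integral {0..b} (lagrangian_along B \<alpha> b L f)"

end

(* Write p, q for the two partial derivatives of L along f and c = B(\<alpha>) / (1 - \<alpha>). Differentiating J
   along f + e u, with u vanishing at 0 and b, gives that the integral of p u + q (ABC u) is zero.
   Fubini on the triangle t \<le> x moves the kernel from u' to q, and integration by parts turns this into
   orthogonality of u' to P + c G, where P is the primitive of p and G the ABR integral of q.
   By du Bois-Reymond P + c G is constant. This yields the differentiability of G as well as the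
   equation p + c G' = 0, up to the endpoints. *)

theory Submission
  imports Defs
begin

section \<open>Convergence of the Mittag-Leffler series and continuity of the kernel\<close>

text \<open>Letting \<open>R\<close> be arbitrarily large makes the Mittag-Leffler series converge everywhere.\<close>

lemma Gamma_lower_bound:
  fixes x R :: real
  assumes "0 \<le> x" "0 < R"
  shows "R powr x * exp (- R) \<le> Gamma (x + 1)"
proof -
  have g: "((\<lambda>t. t powr x / exp t) has_integral Gamma (x + 1)) {0..}"
    using Gamma_integral_real[of "x + 1"] assms by simp
  have e: "((\<lambda>t. R powr x * exp (- t)) has_integral R powr x * exp (- R)) {R..}"
    using has_integral_mult_right[OF has_integral_exp_minus_to_infinity[of 1 R], of "R powr x"] by simp
  \<comment> \<open>Cutting the comparison function off below \<open>R\<close> puts both integrals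
    over \<open>{0..}\<close>. On the tail, \<open>R powr x \<le> t powr x\<close> because
    \<open>0 \<le> x\<close>.\<close>
  have "((\<lambda>t. if t \<in> {R..} then R powr x * exp (- t) else 0) has_integral R powr x * exp (- R)) {0..}"
    using e assms by (subst has_integral_restrict) auto
  then show ?thesis
    by (rule has_integral_le[OF _ g])
      (use assms in \<open>auto simp: exp_minus divide_inverse intro!: powr_mono2\<close>)
qed

text \<open>At \<open>x = \<alpha> * real k\<close> the bound on \<open>Gamma\<close> grows
  geometrically in \<open>k\<close> with ratio \<open>R powr \<alpha>\<close>. Once this ratio
  exceeds \<open>\<bar>z\<bar>\<close>, a geometric series dominates.\<close>

lemma summable_mittag_leffler:
  fixes z :: real
  assumes "0 < \<alpha>"
  shows "summable (\<lambda>k. inverse (Gamma (\<alpha> * real k + 1)) * z ^ k)"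
proof -
  \<comment> \<open>Any positive \<open>M\<close> above \<open>\<bar>z\<bar>\<close> serves; the
    summand 1 covers \<open>z = 0\<close>. Then \<open>R\<close> is the solution of
    \<open>R powr \<alpha> = M\<close>.\<close>
  define M where "M = 2 * \<bar>z\<bar> + 1"
  define R where "R = M powr (1 / \<alpha>)"
  have M: "0 < M" "\<bar>z\<bar> / M < 1" by (auto simp: M_def)
  then have R: "0 < R" "R powr \<alpha> = M" using assms by (auto simp: R_def powr_powr)
  have "summable (\<lambda>k. exp R * (\<bar>z\<bar> / M) ^ k)"
    using M by (intro summable_mult summable_geometric) auto
  then show ?thesis
  proof (rule summable_comparison_test'[where N = 0])
    fix k :: nat
    have pow: "R powr (\<alpha> * real k) = M ^ k"
      using R M by (simp flip: powr_powr add: powr_realpow)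
    have le: "M ^ k * exp (- R) \<le> Gamma (\<alpha> * real k + 1)"
      using Gamma_lower_bound[of "\<alpha> * real k" R] assms R pow by simp
    have pos: "0 < M ^ k * exp (- R)" using M by simp
    have "inverse (Gamma (\<alpha> * real k + 1)) \<le> inverse (M ^ k * exp (- R))"
      using le pos by (rule le_imp_inverse_le)
    moreover have "0 < Gamma (\<alpha> * real k + 1)" using le pos by linarith
    ultimately have "\<bar>inverse (Gamma (\<alpha> * real k + 1)) * z ^ k\<bar> \<le> inverse (M ^ k * exp (- R)) * \<bar>z\<bar> ^ k"
      by (simp add: abs_mult power_abs mult_right_mono)
    then show "norm (inverse (Gamma (\<alpha> * real k + 1)) * z ^ k) \<le> exp R * (\<bar>z\<bar> / M) ^ k"
      by (simp add: exp_minus power_divide field_simps)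
  qed
qed

lemma continuous_on_mittag_leffler:
  assumes "0 < \<alpha>"
  shows "continuous_on UNIV (mittag_leffler \<alpha>)"
proof -
  have "mittag_leffler \<alpha> = (\<lambda>z. \<Sum>k. inverse (Gamma (\<alpha> * real k + 1)) * z ^ k)"
    by (simp add: fun_eq_iff mittag_leffler_def divide_inverse mult.commute)
  then show ?thesis
    using isCont_powser_converges_everywhere[OF summable_mittag_leffler[OF assms]]
    by (simp add: continuous_on_eq_continuous_at)
qed

text \<open>The point \<open>u = 0\<close> is included because \<open>0 < \<alpha>\<close> makes
  \<open>u powr \<alpha>\<close> continuous there. So the kernel
  \<open>ml_kernel \<alpha> (x - t)\<close> has no singularity on the diagonal, and Fubini is
  applied to continuous functions only.\<close>

lemma continuous_on_ml_kernel:
  assumes "0 < \<alpha>"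
  shows "continuous_on {0..} (ml_kernel \<alpha>)"
proof -
  have "continuous_on {0..} (\<lambda>u::real. - \<alpha> * (u powr \<alpha> / (1 - \<alpha>)))"
    unfolding divide_inverse using assms by (intro continuous_intros continuous_on_powr') auto
  then show ?thesis
    unfolding ml_kernel_def
    by (rule continuous_on_compose2[OF continuous_on_mittag_leffler[OF assms]]) auto
qed

section \<open>Integration by parts and Fubini on a triangle\<close>

text \<open>Integrate the product rule. Derivatives within \<open>{a..b}\<close> suffice, which is
  what primitives over \<open>{a..b}\<close> provide at the endpoints.\<close>

lemma integral_by_parts_Icc:
  fixes u v :: "real \<Rightarrow> real"
  assumes "a \<le> b"
    and u: "\<And>x. x \<in> {a..b} \<Longrightarrow> (u has_real_derivative u' x) (at x within {a..b})"
    and v: "\<And>x. x \<in> {a..b} \<Longrightarrow> (v has_real_derivative v' x) (at x within {a..b})"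
    and u': "continuous_on {a..b} u'" and v': "continuous_on {a..b} v'"
  shows "integral {a..b} (\<lambda>x. u' x * v x) = u b * v b - u a * v a - integral {a..b} (\<lambda>x. u x * v' x)"
proof -
  have cu: "continuous_on {a..b} u" and cv: "continuous_on {a..b} v"
    by (rule DERIV_continuous_on[OF u], assumption) (rule DERIV_continuous_on[OF v])
  have "((\<lambda>x. u' x * v x + u x * v' x) has_integral u b * v b - u a * v a) {a..b}"
  proof (rule fundamental_theorem_of_calculus[OF assms(1)])
    fix x assume x: "x \<in> {a..b}"
    show "((\<lambda>x. u x * v x) has_vector_derivative u' x * v x + u x * v' x) (at x within {a..b})"
      using DERIV_mult[OF u[OF x] v[OF x]]
      by (simp add: has_real_derivative_iff_has_vector_derivative algebra_simps)
  qed
  then have "integral {a..b} (\<lambda>x. u' x * v x + u x * v' x) = u b * v b - u a * v a"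
    by (rule integral_unique)
  then show ?thesis
    using cu cv u' v' by (subst (asm) integral_add) (auto intro!: integrable_continuous_real continuous_intros)
qed

text \<open>
  A function on the triangle \<open>a \<le> t \<le> x \<le> b\<close> extends continuously to the square by
  \<open>F t (max t x)\<close>; integrals over slices of the triangle and of the square differ only by
  integrals of the diagonal values, so continuity and Fubini on the square suffice.
\<close>

lemma continuous_on_triangle_extension:
  fixes F :: "real \<Rightarrow> real \<Rightarrow> real"
  assumes "continuous_on {(t, x). a \<le> t \<and> t \<le> x \<and> x \<le> b} (\<lambda>(t, x). F t x)"
  shows "continuous_on ({a..b} \<times> {a..b}) (\<lambda>(t, x). F t (max t x))"
proof -
  have "continuous_on ({a..b} \<times> {a..b}) (\<lambda>p::real \<times> real. (fst p, max (fst p) (snd p)))"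
    by (intro continuous_intros)
  from continuous_on_compose2[OF assms this]
  have "continuous_on ({a..b} \<times> {a..b}) (\<lambda>p. case (fst p, max (fst p) (snd p)) of (t, x) \<Rightarrow> F t x)"
    by (auto simp: image_subset_iff)
  then show ?thesis by (simp add: case_prod_unfold)
qed

lemma continuous_on_triangle_diagonal:
  fixes F :: "real \<Rightarrow> real \<Rightarrow> real"
  assumes "continuous_on {(t, x). a \<le> t \<and> t \<le> x \<and> x \<le> b} (\<lambda>(t, x). F t x)"
  shows "continuous_on {a..b} (\<lambda>t. F t t)"
proof -
  have "continuous_on {a..b} (\<lambda>t. case (t, t) of (t, x) \<Rightarrow> F t x)"
    by (rule continuous_on_compose2[OF assms]) (auto intro!: continuous_intros)
  then show ?thesis by simp
qed

lemma triangle_slice_right: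
  fixes F :: "real \<Rightarrow> real \<Rightarrow> real"
  assumes F: "continuous_on {(t, x). a \<le> t \<and> t \<le> x \<and> x \<le> b} (\<lambda>(t, x). F t x)"
    and t: "t \<in> {a..b}"
  shows "integral {t..b} (F t) = integral {a..b} (\<lambda>x. F t (max t x)) - (t - a) * F t t"
proof -
  have "continuous_on {a..b} (\<lambda>x. case (t, x) of (t, x) \<Rightarrow> F t (max t x))"
    by (rule continuous_on_compose2[OF continuous_on_triangle_extension[OF F]])
      (use t in \<open>auto intro!: continuous_intros\<close>)
  then have "continuous_on {a..b} (\<lambda>x. F t (max t x))" by simp
  then have "integral {a..t} (\<lambda>x. F t (max t x)) + integral {t..b} (\<lambda>x. F t (max t x))
      = integral {a..b} (\<lambda>x. F t (max t x))"
    using t by (intro Henstock_Kurzweil_Integration.integral_combine integrable_continuous_real) auto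
  moreover have "integral {a..t} (\<lambda>x. F t (max t x)) = integral {a..t} (\<lambda>x. F t t)"
    by (intro integral_cong) (auto simp: max_def)
  moreover have "integral {t..b} (\<lambda>x. F t (max t x)) = integral {t..b} (F t)"
    by (intro integral_cong) (auto simp: max_def)
  ultimately show ?thesis using t by simp
qed

text \<open>The extension is not symmetric in its variables: for \<open>t > x\<close> it equals
  \<open>F t t\<close>, which still varies with \<open>t\<close>. Hence the correction is an
  integral and not a multiple of one value as in \<open>triangle_slice_right\<close>.\<close>

lemma triangle_slice_left:
  fixes F :: "real \<Rightarrow> real \<Rightarrow> real"
  assumes F: "continuous_on {(t, x). a \<le> t \<and> t \<le> x \<and> x \<le> b} (\<lambda>(t, x). F t x)"
    and x: "x \<in> {a..b}"
  shows "integral {a..x} (\<lambda>t. F t x)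
    = integral {a..b} (\<lambda>t. F t (max t x)) - integral {x..b} (\<lambda>t. F t t)"
proof -
  have "continuous_on {a..b} (\<lambda>t. case (t, x) of (t, x) \<Rightarrow> F t (max t x))"
    by (rule continuous_on_compose2[OF continuous_on_triangle_extension[OF F]])
      (use x in \<open>auto intro!: continuous_intros\<close>)
  then have "continuous_on {a..b} (\<lambda>t. F t (max t x))" by simp
  then have "integral {a..x} (\<lambda>t. F t (max t x)) + integral {x..b} (\<lambda>t. F t (max t x))
      = integral {a..b} (\<lambda>t. F t (max t x))"
    using x by (intro Henstock_Kurzweil_Integration.integral_combine integrable_continuous_real) auto
  moreover have "integral {a..x} (\<lambda>t. F t (max t x)) = integral {a..x} (\<lambda>t. F t x)"
    by (intro integral_cong) (auto simp: max_def)
  moreover have "integral {x..b} (\<lambda>t. F t (max t x)) = integral {x..b} (\<lambda>t. F t t)"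
    by (intro integral_cong) (auto simp: max_def)
  ultimately show ?thesis by simp
qed

lemma continuous_on_square_integral_fst:
  fixes G :: "real \<Rightarrow> real \<Rightarrow> real"
  assumes "continuous_on ({a..b} \<times> {a..b}) (\<lambda>(t, x). G t x)"
  shows "continuous_on {a..b} (\<lambda>x. integral {a..b} (\<lambda>t. G t x))"
proof -
  have "continuous_on ({a..b} \<times> {a..b}) (\<lambda>(x, t). G t x)"
    using continuous_on_swap_args[of "{a..b}" "{a..b}" G] assms by simp
  then show ?thesis
    using integral_continuous_on_param[of "{a..b}" a b "\<lambda>x t. G t x"] by simp
qed

lemma continuous_on_triangle_right:
  fixes F :: "real \<Rightarrow> real \<Rightarrow> real"
  assumes F: "continuous_on {(t, x). a \<le> t \<and> t \<le> x \<and> x \<le> b} (\<lambda>(t, x). F t x)"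
  shows "continuous_on {a..b} (\<lambda>t. integral {t..b} (F t))"
proof -
  have "continuous_on {a..b} (\<lambda>t. integral {a..b} (\<lambda>x. F t (max t x)))"
    using integral_continuous_on_param[of "{a..b}" a b "\<lambda>t x. F t (max t x)"]
      continuous_on_triangle_extension[OF F] by simp
  then have "continuous_on {a..b} (\<lambda>t. integral {a..b} (\<lambda>x. F t (max t x)) - (t - a) * F t t)"
    by (intro continuous_intros continuous_on_triangle_diagonal[OF F])
  then show ?thesis
    by (rule continuous_on_eq) (simp add: triangle_slice_right[OF F])
qed

lemma continuous_on_triangle_left:
  fixes F :: "real \<Rightarrow> real \<Rightarrow> real"
  assumes F: "continuous_on {(t, x). a \<le> t \<and> t \<le> x \<and> x \<le> b} (\<lambda>(t, x). F t x)"
  shows "continuous_on {a..b} (\<lambda>x. integral {a..x} (\<lambda>t. F t x))"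
proof -
  have "continuous_on {a..b}
      (\<lambda>x. integral {a..b} (\<lambda>t. F t (max t x)) - integral {x..b} (\<lambda>t. F t t))"
    by (intro continuous_intros indefinite_integral_continuous_1' integrable_continuous_real
        continuous_on_triangle_diagonal[OF F] continuous_on_square_integral_fst
        continuous_on_triangle_extension[OF F])
  then show ?thesis
    by (rule continuous_on_eq) (simp add: triangle_slice_left[OF F])
qed

text \<open>Each side is an iterated integral over the square minus a diagonal correction. Fubini
  matches the former, integration by parts the latter.\<close>

lemma triangle_integral_swap:
  fixes F :: "real \<Rightarrow> real \<Rightarrow> real"
  assumes "a \<le> b"
    and F: "continuous_on {(t, x). a \<le> t \<and> t \<le> x \<and> x \<le> b} (\<lambda>(t, x). F t x)"
  shows "integral {a..b} (\<lambda>t. integral {t..b} (F t))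
    = integral {a..b} (\<lambda>x. integral {a..x} (\<lambda>t. F t x))"
proof -
  note E = continuous_on_triangle_extension[OF F] and D = continuous_on_triangle_diagonal[OF F]
  have c1: "continuous_on {a..b} (\<lambda>t. integral {a..b} (\<lambda>x. F t (max t x)))"
    using integral_continuous_on_param[of "{a..b}" a b "\<lambda>t x. F t (max t x)"] E by simp
  note c2 = continuous_on_square_integral_fst[OF E]
  have shift: "((\<lambda>t. t - a) has_real_derivative 1) (at t within {a..b})" for t
    by (auto intro!: derivative_eq_intros)
  have c3: "continuous_on {a..b} (\<lambda>t. integral {t..b} (\<lambda>s. F s s))"
    by (intro indefinite_integral_continuous_1' integrable_continuous_real D)
  have "integral {a..b} (\<lambda>t. integral {t..b} (F t))
      = integral {a..b} (\<lambda>t. integral {a..b} (\<lambda>x. F t (max t x)) - (t - a) * F t t)"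
    by (intro integral_cong) (simp add: triangle_slice_right[OF F])
  also have "\<dots> = integral {a..b} (\<lambda>t. integral {a..b} (\<lambda>x. F t (max t x)))
      - integral {a..b} (\<lambda>t. (t - a) * F t t)"
    by (intro integral_diff integrable_continuous_real continuous_intros c1 D)
  also have "integral {a..b} (\<lambda>t. integral {a..b} (\<lambda>x. F t (max t x)))
      = integral {a..b} (\<lambda>x. integral {a..b} (\<lambda>t. F t (max t x)))"
    using integral_swap_continuous[of a a b b "\<lambda>t x. F t (max t x)"] E
    by (simp add: cbox_Pair_eq)
  \<comment> \<open>No boundary terms remain: \<open>t - a\<close> vanishes at \<open>a\<close>, and
    the integral over \<open>{t..b}\<close> vanishes at \<open>b\<close>.\<close>
  also have "integral {a..b} (\<lambda>t. (t - a) * F t t) = integral {a..b} (\<lambda>t. integral {t..b} (\<lambda>s. F s s))"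
    using integral_by_parts_Icc[OF assms(1) shift integral_has_real_derivative'[OF D]] D
    by (simp add: continuous_on_minus)
  also have "integral {a..b} (\<lambda>x. integral {a..b} (\<lambda>t. F t (max t x)))
        - integral {a..b} (\<lambda>t. integral {t..b} (\<lambda>s. F s s))
      = integral {a..b} (\<lambda>x. integral {a..b} (\<lambda>t. F t (max t x)) - integral {x..b} (\<lambda>s. F s s))"
    by (intro integral_diff[symmetric] integrable_continuous_real c2 c3)
  also have "\<dots> = integral {a..b} (\<lambda>x. integral {a..x} (\<lambda>t. F t x))"
    by (intro integral_cong) (simp add: triangle_slice_left[OF F])
  finally show ?thesis .
qed

section \<open>The du Bois-Reymond lemma\<close>

text \<open>Orthogonality is asked only for test functions that keep a variation in
  \<open>C2_on b\<close> with fixed boundary values. Since \<open>h\<close> is merely continuous, it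
  cannot serve as \<open>u'\<close> itself and has to be approximated.\<close>

lemma du_Bois_Reymond:
  fixes h :: "real \<Rightarrow> real"
  assumes "0 < b" and h: "continuous_on {0..b} h"
    and orth: "\<And>u u' u''. \<lbrakk>\<And>x. (u has_real_derivative u' x) (at x);
      \<And>x. (u' has_real_derivative u'' x) (at x); continuous_on UNIV u''; u 0 = 0; u b = 0\<rbrakk>
      \<Longrightarrow> integral {0..b} (\<lambda>x. u' x * h x) = 0"
  shows "h constant_on {0..b}"
proof -
  \<comment> \<open>Test against \<open>u' = p - \<mu>\<close>, where \<open>p\<close> is a polynomial close to the mean-free part \<open>k\<close> of \<open>h\<close>
    and \<open>\<mu>\<close> is the mean of \<open>p\<close>; in the limit the square of \<open>k\<close> has integral zero.\<close>
  define m where "m = integral {0..b} h / b"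
  define k where "k x = h x - m" for x
  have k: "continuous_on {0..b} k" unfolding k_def by (intro continuous_intros h)
  have k0: "integral {0..b} k = 0"
    unfolding k_def using h assms(1) by (subst integral_diff) (auto intro!: integrable_continuous_real simp: m_def)
  note int = integrable_continuous_real
  have bound: "\<bar>integral {0..b} (\<lambda>x. k x * k x)\<bar> \<le> e * integral {0..b} (\<lambda>x. \<bar>k x\<bar>)" if e: "0 < e" for e
  proof -
    obtain p where p: "real_polynomial_function p" "\<And>x. x \<in> {0..b} \<Longrightarrow> \<bar>k x - p x\<bar> < e"
      using Stone_Weierstrass_real_polynomial_function[of "{0..b}" k e] k e by auto
    obtain p' where p': "real_polynomial_function p'" "\<And>x. (p has_real_derivative p' x) (at x)"
      using has_real_derivative_polynomial_function[OF p(1)] by blast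
    obtain P where P: "\<And>x. (P has_real_derivative p x) (at x)"
    proof -
      obtain c n where c: "p = (\<lambda>x. \<Sum>i\<le>n. c i * x ^ i)"
        using p(1) by (auto simp: real_polynomial_function_iff_sum)
      have "((\<lambda>x. \<Sum>i\<le>n. c i * x ^ Suc i / Suc i) has_real_derivative p x) (at x)" for x
        unfolding c by (auto intro!: derivative_eq_intros sum.cong simp del: of_nat_Suc power_Suc)
      then show thesis by (rule that)
    qed
    have cp: "continuous_on S p" for S
      using p'(2) by (meson DERIV_isCont continuous_at_imp_continuous_on)
    have cp': "continuous_on S p'" for S
      using p'(1) by (simp add: continuous_on_polymonial_function real_polynomial_function_eq)
    \<comment> \<open>The slope of the chord of \<open>P\<close> over \<open>{0..b}\<close>;
      subtracting the chord makes \<open>u\<close> vanish at both ends.\<close>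
    define \<mu> where "\<mu> = (P b - P 0) / b"
    define u where "u x = P x - P 0 - \<mu> * x" for x
    have "integral {0..b} (\<lambda>x. (p x - \<mu>) * h x) = 0"
    proof (rule orth)
      show "(u has_real_derivative p x - \<mu>) (at x)" for x
        unfolding u_def by (auto intro!: derivative_eq_intros P)
      show "((\<lambda>x. p x - \<mu>) has_real_derivative p' x) (at x)" for x
        by (auto intro!: derivative_eq_intros p')
    qed (use assms(1) cp' in \<open>auto simp: u_def \<mu>_def\<close>)
    \<comment> \<open>As \<open>p - \<mu>\<close> has mean zero, replacing \<open>h\<close> by
      \<open>k = h - m\<close> does not change the integral.\<close>
    moreover have "(p has_integral P b - P 0) {0..b}"
      using assms(1) P by (intro fundamental_theorem_of_calculus)
        (auto simp flip: has_real_derivative_iff_has_vector_derivative intro: has_field_derivative_at_within)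
    then have "integral {0..b} (\<lambda>x. p x - \<mu>) = 0"
      using assms(1) by (subst integral_diff) (auto simp: \<mu>_def intro: integral_unique)
    moreover have "integral {0..b} (\<lambda>x. (p x - \<mu>) * k x)
        = integral {0..b} (\<lambda>x. (p x - \<mu>) * h x) - integral {0..b} (\<lambda>x. (p x - \<mu>) * m)"
      unfolding k_def right_diff_distrib
      by (intro integral_diff int continuous_intros cp h)
    ultimately have "integral {0..b} (\<lambda>x. (p x - \<mu>) * k x) = 0" by simp
    \<comment> \<open>Since \<open>k\<close> also has mean zero, the constant \<mu> drops out and
      \<open>k\<close> is orthogonal to \<open>p\<close> itself. Only the approximation error is
      left in the integral of the square.\<close>
    moreover have "integral {0..b} (\<lambda>x. \<mu> * k x) = 0" using k0 by simp
    moreover have "integral {0..b} (\<lambda>x. (k x - p x) * k x) = integral {0..b} (\<lambda>x. k x * k x)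
        - integral {0..b} (\<lambda>x. (p x - \<mu>) * k x) - integral {0..b} (\<lambda>x. \<mu> * k x)"
      by (subst integral_diff[symmetric], (intro int continuous_intros cp k)+)+
        (simp add: algebra_simps)
    ultimately have "integral {0..b} (\<lambda>x. k x * k x) = integral {0..b} (\<lambda>x. (k x - p x) * k x)"
      by simp
    also have "\<bar>\<dots>\<bar> \<le> integral {0..b} (\<lambda>x. e * \<bar>k x\<bar>)"
      unfolding real_norm_def[symmetric]
      by (rule integral_norm_bound_integral)
        (use p(2) in \<open>auto intro!: int continuous_intros cp k mult_right_mono simp: abs_mult less_imp_le\<close>)
    finally show ?thesis by simp
  qed
  have "\<bar>integral {0..b} (\<lambda>x. k x * k x)\<bar> \<le> 0"
  proof (rule field_le_epsilon)
    fix e :: real assume "0 < e"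
    \<comment> \<open>\<open>N\<close> may be zero, so \<open>bound\<close> is applied with
      \<open>e / (N + 1)\<close>.\<close>
    define N where "N = integral {0..b} (\<lambda>x. \<bar>k x\<bar>)"
    have N: "0 \<le> N" unfolding N_def by (intro integral_nonneg int continuous_intros k) auto
    have "\<bar>integral {0..b} (\<lambda>x. k x * k x)\<bar> \<le> e / (N + 1) * N"
      unfolding N_def[symmetric] using N \<open>0 < e\<close>
      by (intro bound[folded N_def] divide_pos_pos) auto
    also have "\<dots> \<le> e" using N \<open>0 < e\<close> by (simp add: field_simps)
    finally show "\<bar>integral {0..b} (\<lambda>x. k x * k x)\<bar> \<le> 0 + e" by simp
  qed
  then have "integral {0..b} (\<lambda>x. k x * k x) = 0" by simp
  then have "\<forall>x\<in>{0..b}. k x * k x = 0"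
    using integral_eq_0_iff[of 0 b "\<lambda>x. k x * k x"] continuous_on_mult[OF k k] assms(1) by simp
  then show ?thesis unfolding constant_on_def by (auto simp: k_def)
qed

section \<open>Differentiation along a line in the plane\<close>

text \<open>Existence of both partial derivatives and joint continuity of the second give total
  differentiability at each point; the chain rule does the rest. It is applied to \<open>L t\<close>
  for fixed \<open>t\<close>.\<close>

lemma has_real_derivative_along_line:
  fixes h h1 h2 :: "real \<Rightarrow> real \<Rightarrow> real"
  assumes h1: "\<And>y z. ((\<lambda>u. h u z) has_real_derivative h1 y z) (at y)"
    and h2: "\<And>y z. ((\<lambda>u. h y u) has_real_derivative h2 y z) (at z)"
    and cont: "continuous_on UNIV (\<lambda>(y, z). h2 y z)"
  shows "((\<lambda>e. h (y + e * v) (z + e * w)) has_real_derivative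
    h1 (y + e * v) (z + e * w) * v + h2 (y + e * v) (z + e * w) * w) (at e)"
proof -
  define p where "p = (\<lambda>e. (y + e * v, z + e * w))"
  have "((\<lambda>(y, z). h y z) has_derivative
      (\<lambda>(ty, tz). h1 (fst (p e)) (snd (p e)) * ty + blinfun_mult_right (h2 (fst (p e)) (snd (p e))) tz))
      (at (fst (p e), snd (p e)) within UNIV \<times> UNIV)"
  proof (rule has_derivative_partialsI)
    show "((\<lambda>x. h x (snd (p e))) has_derivative (*) (h1 (fst (p e)) (snd (p e)))) (at (fst (p e)))"
      using h1 by (simp add: has_field_derivative_def)
    show "((\<lambda>y. h x y) has_derivative blinfun_apply (blinfun_mult_right (h2 x y))) (at y)" for x y
      using h2 by (simp add: has_field_derivative_def)
    \<comment> \<open>Continuity is required of the second partial derivative as a bounded linear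
      map; \<open>blinfun_mult_right\<close> carries numbers to such maps continuously.\<close>
    have "continuous_on UNIV (\<lambda>q. blinfun_mult_right (case q of (y, z) \<Rightarrow> h2 y z))"
      by (intro bounded_linear.continuous_on[OF bounded_linear_blinfun_mult_right] cont)
    then have "isCont (\<lambda>q. blinfun_mult_right (case q of (y, z) \<Rightarrow> h2 y z)) (p e)"
      by (metis UNIV_I continuous_on_eq_continuous_at open_UNIV)
    then show "continuous (at (fst (p e), snd (p e)) within UNIV \<times> UNIV) (\<lambda>(x, y). blinfun_mult_right (h2 x y))"
      by (simp add: case_prod_unfold)
  qed auto
  moreover have "(p has_derivative (\<lambda>d. (d * v, d * w))) (at e)"
    unfolding p_def by (auto intro!: derivative_eq_intros)
  ultimately have "((\<lambda>e. case p e of (y, z) \<Rightarrow> h y z) has_derivative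
      (\<lambda>d. h1 (fst (p e)) (snd (p e)) * (d * v) + h2 (fst (p e)) (snd (p e)) * (d * w))) (at e)"
    using has_derivative_compose[of p _ e UNIV] by fastforce
  then have "((\<lambda>e. h (y + e * v) (z + e * w)) has_derivative
      (\<lambda>d. h1 (y + e * v) (z + e * w) * (d * v) + h2 (y + e * v) (z + e * w) * (d * w))) (at e)"
    by (simp add: p_def)
  then show ?thesis
    unfolding has_field_derivative_def
    by (rule has_derivative_eq_rhs) (simp add: fun_eq_iff algebra_simps)
qed

section \<open>The fractional operators: continuity, linearity, adjointness\<close>

lemma continuous_on_kernel_triangle:
  assumes "0 < \<alpha>" and "continuous_on {(t, x). a \<le> t \<and> t \<le> x \<and> x \<le> b} G"
  shows "continuous_on {(t, x). a \<le> t \<and> t \<le> x \<and> x \<le> b} (\<lambda>(t, x). G (t, x) * ml_kernel \<alpha> (x - t))"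
proof -
  have "continuous_on {(t, x). a \<le> t \<and> t \<le> x \<and> x \<le> b} (\<lambda>p. ml_kernel \<alpha> (snd p - fst p))"
    by (rule continuous_on_compose2[OF continuous_on_ml_kernel[OF assms(1)]])
      (auto intro!: continuous_intros)
  from continuous_on_mult[OF assms(2) this] show ?thesis by (simp add: case_prod_unfold)
qed

text \<open>Because \<open>0 < b\<close>, derivatives within \<open>{0..b}\<close> are unique, so
  the \<open>vector_derivative\<close> in the definition can be replaced by any known
  derivative.\<close>

lemma ABC_right_eq:
  assumes "0 < b" "t \<in> {0..b}"
    and "\<And>x. x \<in> {0..b} \<Longrightarrow> (g has_real_derivative g' x) (at x within {0..b})"
  shows "ABC_right B \<alpha> b g t = - (B \<alpha> / (1 - \<alpha>)) * integral {t..b} (\<lambda>x. g' x * ml_kernel \<alpha> (x - t))"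
proof -
  have "vector_derivative g (at x within {0..b}) = g' x" if "x \<in> {0..b}" for x
    using vector_derivative_within_closed_interval[OF assms(1) that] assms(3)[OF that]
    by (simp add: has_real_derivative_iff_has_vector_derivative)
  then show ?thesis
    unfolding ABC_right_def using assms(2)
    by (intro arg_cong2[where f = "(*)"] refl integral_cong) auto
qed

lemma continuous_on_ABC_right:
  assumes "0 < \<alpha>" "0 < b"
    and g: "\<And>x. x \<in> {0..b} \<Longrightarrow> (g has_real_derivative g' x) (at x within {0..b})"
    and g': "continuous_on {0..b} g'"
  shows "continuous_on {0..b} (ABC_right B \<alpha> b g)"
proof -
  have "continuous_on {(t, x). 0 \<le> t \<and> t \<le> x \<and> x \<le> b} (\<lambda>p. g' (snd p))"
    by (rule continuous_on_compose2[OF g']) (auto intro!: continuous_intros)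
  from continuous_on_triangle_right[OF continuous_on_kernel_triangle[OF assms(1) this, unfolded snd_conv]]
  have "continuous_on {0..b} (\<lambda>t. - (B \<alpha> / (1 - \<alpha>)) * integral {t..b} (\<lambda>x. g' x * ml_kernel \<alpha> (x - t)))"
    by (intro continuous_intros)
  then show ?thesis
    by (rule continuous_on_eq) (rule ABC_right_eq[OF assms(2) _ g, symmetric])
qed

text \<open>Linearity makes the third argument of \<open>L\<close> affine in \<open>e\<close> along
  a variation, the form that \<open>has_real_derivative_along_line\<close> handles.\<close>

lemma ABC_right_add_scale:
  assumes "0 < \<alpha>" "0 < b" "t \<in> {0..b}"
    and f: "\<And>x. x \<in> {0..b} \<Longrightarrow> (f has_real_derivative f' x) (at x within {0..b})"
    and f': "continuous_on {0..b} f'"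
    and g: "\<And>x. x \<in> {0..b} \<Longrightarrow> (g has_real_derivative g' x) (at x within {0..b})"
    and g': "continuous_on {0..b} g'"
  shows "ABC_right B \<alpha> b (\<lambda>x. f x + e * g x) t = ABC_right B \<alpha> b f t + e * ABC_right B \<alpha> b g t"
proof -
  have ker: "continuous_on {t..b} (\<lambda>x. ml_kernel \<alpha> (x - t))"
    by (rule continuous_on_compose2[OF continuous_on_ml_kernel[OF assms(1)]])
      (auto intro!: continuous_intros)
  have int: "(\<lambda>x. h x * ml_kernel \<alpha> (x - t)) integrable_on {t..b}" if "continuous_on {0..b} h" for h
    using assms(3)
    by (intro integrable_continuous_real continuous_on_mult ker continuous_on_subset[OF that]) auto
  have fg: "((\<lambda>x. f x + e * g x) has_real_derivative f' x + e * g' x) (at x within {0..b})"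
    if "x \<in> {0..b}" for x
    using f[OF that] g[OF that] by (auto intro!: derivative_eq_intros)
  have "integral {t..b} (\<lambda>x. (f' x + e * g' x) * ml_kernel \<alpha> (x - t))
      = integral {t..b} (\<lambda>x. f' x * ml_kernel \<alpha> (x - t) + e * (g' x * ml_kernel \<alpha> (x - t)))"
    by (simp add: algebra_simps)
  also have "\<dots> = integral {t..b} (\<lambda>x. f' x * ml_kernel \<alpha> (x - t))
      + e * integral {t..b} (\<lambda>x. g' x * ml_kernel \<alpha> (x - t))"
    by (subst integral_add) (auto intro!: int f' g' integrable_on_mult_right)
  finally have int_eq: "integral {t..b} (\<lambda>x. (f' x + e * g' x) * ml_kernel \<alpha> (x - t))
    = integral {t..b} (\<lambda>x. f' x * ml_kernel \<alpha> (x - t))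
      + e * integral {t..b} (\<lambda>x. g' x * ml_kernel \<alpha> (x - t))" .
  have "ABC_right B \<alpha> b f t = - (B \<alpha> / (1 - \<alpha>)) * integral {t..b} (\<lambda>x. f' x * ml_kernel \<alpha> (x - t))"
    by (rule ABC_right_eq[OF assms(2,3) f])
  moreover have "ABC_right B \<alpha> b g t = - (B \<alpha> / (1 - \<alpha>)) * integral {t..b} (\<lambda>x. g' x * ml_kernel \<alpha> (x - t))"
    by (rule ABC_right_eq[OF assms(2,3) g])
  moreover have "ABC_right B \<alpha> b (\<lambda>x. f x + e * g x) t
      = - (B \<alpha> / (1 - \<alpha>)) * integral {t..b} (\<lambda>x. (f' x + e * g' x) * ml_kernel \<alpha> (x - t))"
    by (rule ABC_right_eq[OF assms(2,3) fg])
  ultimately show ?thesis by (simp only: int_eq) (simp add: algebra_simps)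
qed

text \<open>Exchanging the order of integration collects \<open>q\<close> and the kernel into the
  ABR integral at \<open>x\<close>. The derivative stays on \<open>g\<close>, as differentiability
  of \<open>ABR_integral \<alpha> q\<close> is not yet available.\<close>

lemma ABC_right_adjoint:
  assumes "0 < \<alpha>" "0 < b"
    and g: "\<And>x. x \<in> {0..b} \<Longrightarrow> (g has_real_derivative g' x) (at x within {0..b})"
    and g': "continuous_on {0..b} g'" and q: "continuous_on {0..b} q"
  shows "integral {0..b} (\<lambda>t. q t * ABC_right B \<alpha> b g t)
    = - (B \<alpha> / (1 - \<alpha>)) * integral {0..b} (\<lambda>x. g' x * ABR_integral \<alpha> q x)"
proof -
  let ?c = "- (B \<alpha> / (1 - \<alpha>))"
  have "continuous_on {(t, x). 0 \<le> t \<and> t \<le> x \<and> x \<le> b} (\<lambda>p. q (fst p) * g' (snd p))"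
    by (intro continuous_on_mult continuous_on_compose2[OF g'] continuous_on_compose2[OF q])
      (auto intro!: continuous_intros)
  from continuous_on_kernel_triangle[OF assms(1) this, unfolded fst_conv snd_conv]
  have F: "continuous_on {(t, x). 0 \<le> t \<and> t \<le> x \<and> x \<le> b} (\<lambda>(t, x). q t * g' x * ml_kernel \<alpha> (x - t))" .
  have "integral {0..b} (\<lambda>t. q t * ABC_right B \<alpha> b g t)
      = integral {0..b} (\<lambda>t. ?c * integral {t..b} (\<lambda>x. q t * g' x * ml_kernel \<alpha> (x - t)))"
  proof (rule integral_cong)
    fix t assume t: "t \<in> {0..b}"
    have "ABC_right B \<alpha> b g t = ?c * integral {t..b} (\<lambda>x. g' x * ml_kernel \<alpha> (x - t))"
      by (rule ABC_right_eq[OF assms(2) t g])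
    then show "q t * ABC_right B \<alpha> b g t = ?c * integral {t..b} (\<lambda>x. q t * g' x * ml_kernel \<alpha> (x - t))"
      by (simp add: mult.assoc mult.left_commute[of "q t" "B \<alpha>"])
  qed
  also have "\<dots> = ?c * integral {0..b} (\<lambda>x. integral {0..x} (\<lambda>t. q t * g' x * ml_kernel \<alpha> (x - t)))"
    using triangle_integral_swap[OF _ F] assms(2) by simp
  also have "(\<lambda>x. integral {0..x} (\<lambda>t. q t * g' x * ml_kernel \<alpha> (x - t)))
      = (\<lambda>x. g' x * ABR_integral \<alpha> q x)"
    by (simp add: ABR_integral_def fun_eq_iff flip: integral_mult_right) (simp add: mult_ac)
  finally show ?thesis .
qed

lemma continuous_on_ABR_integral:
  assumes "0 < \<alpha>" and q: "continuous_on {0..b} q"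
  shows "continuous_on {0..b} (ABR_integral \<alpha> q)"
proof -
  have "continuous_on {(t, x). 0 \<le> t \<and> t \<le> x \<and> x \<le> b} (\<lambda>p. q (fst p))"
    by (rule continuous_on_compose2[OF q]) (auto intro!: continuous_intros)
  from continuous_on_triangle_left[OF continuous_on_kernel_triangle[OF assms(1) this, unfolded fst_conv]]
  show ?thesis by (simp add: ABR_integral_def[abs_def])
qed

section \<open>Admissible variations and the first variation of the action\<close>

lemma C2_on_D:
  assumes "f \<in> C2_on b"
  obtains f' where "\<And>t. t \<in> {0..b} \<Longrightarrow> (f has_real_derivative f' t) (at t within {0..b})"
    and "continuous_on {0..b} f'"
proof -
  obtain f' f'' where f: "\<And>t. t \<in> {0..b} \<Longrightarrow> (f has_real_derivative f' t) (at t within {0..b})"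
    "\<And>t. t \<in> {0..b} \<Longrightarrow> (f' has_real_derivative f'' t) (at t within {0..b})"
    using assms unfolding C2_on_def by blast
  show thesis by (rule that[OF f(1) DERIV_continuous_on[OF f(2)]])
qed

lemma C2_on_add_scale:
  assumes "f \<in> C2_on b"
    and "\<And>x. (u has_real_derivative u' x) (at x)" "\<And>x. (u' has_real_derivative u'' x) (at x)"
    and "continuous_on UNIV u''"
  shows "(\<lambda>x. f x + e * u x) \<in> C2_on b"
proof -
  obtain f' f'' where f: "\<And>t. t \<in> {0..b} \<Longrightarrow> (f has_real_derivative f' t) (at t within {0..b})"
    "\<And>t. t \<in> {0..b} \<Longrightarrow> (f' has_real_derivative f'' t) (at t within {0..b})"
    "continuous_on {0..b} f''"
    using assms(1) unfolding C2_on_def by blast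
  have "continuous_on {0..b} (\<lambda>x. f'' x + e * u'' x)"
    by (intro continuous_intros f continuous_on_subset[OF assms(4)]) auto
  moreover have "((\<lambda>x. f x + e * u x) has_real_derivative f' t + e * u' t) (at t within {0..b})"
    "((\<lambda>x. f' x + e * u' x) has_real_derivative f'' t + e * u'' t) (at t within {0..b})"
    if "t \<in> {0..b}" for t
    by (auto intro!: derivative_eq_intros f that has_field_derivative_at_within[OF assms(2)]
        has_field_derivative_at_within[OF assms(3)])
  ultimately show ?thesis unfolding C2_on_def mem_Collect_eq
    by (intro exI[of _ "\<lambda>x. f' x + e * u' x"] exI[of _ "\<lambda>x. f'' x + e * u'' x"] conjI ballI)
qed

text \<open>Here \<open>M\<close> stands for a partial derivative of \<open>L\<close>; the result is
  the continuity of both coefficients in the first variation.\<close>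

lemma continuous_on_lagrangian_along:
  assumes "continuous_on ({0..b} \<times> UNIV) (\<lambda>(t, y, z). M t y z)"
    and "continuous_on {0..b} f" "continuous_on {0..b} (ABC_right B \<alpha> b f)"
  shows "continuous_on {0..b} (lagrangian_along B \<alpha> b M f)"
proof -
  have "continuous_on {0..b} (\<lambda>t. (t, f t, ABC_right B \<alpha> b f t))"
    by (intro continuous_intros assms)
  from continuous_on_compose2[OF assms(1) this] show ?thesis
    by (auto simp: lagrangian_along_def[abs_def])
qed

text \<open>The Leibniz rule applies because the \<open>e\<close>-derivative of the integrand is
  jointly continuous in \<open>e\<close> and \<open>t\<close>. Integrability for each
  \<open>e\<close> is a separate hypothesis, since continuity in \<open>t\<close> is assumed for the
  partial derivatives and not for \<open>L\<close>.\<close>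

lemma has_real_derivative_action_functional:
  assumes "0 < \<alpha>" "0 < b"
    and deriv_y: "\<And>t y z. t \<in> {0..b} \<Longrightarrow> ((\<lambda>u. L t u z) has_real_derivative L_y t y z) (at y)"
    and deriv_z: "\<And>t y z. t \<in> {0..b} \<Longrightarrow> ((\<lambda>u. L t y u) has_real_derivative L_z t y z) (at z)"
    and cont_y: "continuous_on ({0..b} \<times> UNIV) (\<lambda>(t, y, z). L_y t y z)"
    and cont_z: "continuous_on ({0..b} \<times> UNIV) (\<lambda>(t, y, z). L_z t y z)"
    and f: "\<And>x. x \<in> {0..b} \<Longrightarrow> (f has_real_derivative f' x) (at x within {0..b})"
    and f': "continuous_on {0..b} f'"
    and u: "\<And>x. x \<in> {0..b} \<Longrightarrow> (u has_real_derivative u' x) (at x within {0..b})"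
    and u': "continuous_on {0..b} u'"
    and int: "\<And>e. lagrangian_along B \<alpha> b L (\<lambda>x. f x + e * u x) integrable_on {0..b}"
  shows "((\<lambda>e. action_functional B \<alpha> b L (\<lambda>x. f x + e * u x)) has_real_derivative
    integral {0..b} (\<lambda>t. lagrangian_along B \<alpha> b L_y f t * u t
      + lagrangian_along B \<alpha> b L_z f t * ABC_right B \<alpha> b u t)) (at 0)"
proof -
  define Df where "Df = ABC_right B \<alpha> b f"
  define Du where "Du = ABC_right B \<alpha> b u"
  have cf: "continuous_on {0..b} f" and cu: "continuous_on {0..b} u"
    by (rule DERIV_continuous_on[OF f], assumption) (rule DERIV_continuous_on[OF u])
  have cDf: "continuous_on {0..b} Df" and cDu: "continuous_on {0..b} Du"
    unfolding Df_def Du_def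
    using continuous_on_ABC_right[OF assms(1,2) f f'] continuous_on_ABC_right[OF assms(1,2) u u'] by auto
  have L_eq: "lagrangian_along B \<alpha> b L (\<lambda>x. f x + e * u x) t = L t (f t + e * u t) (Df t + e * Du t)"
    if "t \<in> {0..b}" for e t
    using ABC_right_add_scale[OF assms(1,2) that f f' u u'] by (simp add: lagrangian_along_def Df_def Du_def)
  define G where "G e t = L_y t (f t + e * u t) (Df t + e * Du t) * u t
    + L_z t (f t + e * u t) (Df t + e * Du t) * Du t" for e t
  have snd: "continuous_on (UNIV \<times> {0..b}) (\<lambda>p::real \<times> real. h (snd p))"
    if "continuous_on {0..b} h" for h :: "real \<Rightarrow> real"
    by (rule continuous_on_compose2[OF that]) (auto intro!: continuous_intros)
  have path: "continuous_on (UNIV \<times> {0..b}) (\<lambda>p::real \<times> real.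
      (snd p, f (snd p) + fst p * u (snd p), Df (snd p) + fst p * Du (snd p)))"
    by (intro continuous_intros snd cf cu cDf cDu)
  have par: "continuous_on (UNIV \<times> {0..b}) (\<lambda>p::real \<times> real.
      M (snd p) (f (snd p) + fst p * u (snd p)) (Df (snd p) + fst p * Du (snd p)))"
    if "continuous_on ({0..b} \<times> UNIV) (\<lambda>(t, y, z). M t y z)" for M :: "real \<Rightarrow> real \<Rightarrow> real \<Rightarrow> real"
    using continuous_on_compose2[OF that path] by (auto simp: image_subset_iff)
  have "continuous_on (UNIV \<times> {0..b}) (\<lambda>p. G (fst p) (snd p))"
    unfolding G_def
    by (intro continuous_on_add continuous_on_mult snd cu cDu par[OF cont_y] par[OF cont_z])
  then have G: "continuous_on (UNIV \<times> cbox 0 b) (\<lambda>(e, t). G e t)"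
    by (simp add: case_prod_unfold)
  have "((\<lambda>e. integral (cbox 0 b) (\<lambda>t. L t (f t + e * u t) (Df t + e * Du t)))
      has_real_derivative integral (cbox 0 b) (G 0)) (at 0 within UNIV)"
  proof (rule leibniz_rule_field_derivative[OF _ _ G])
    fix e t :: real assume t: "t \<in> cbox 0 b"
    \<comment> \<open>Freezing \<open>t\<close> turns joint continuity of \<open>L_z\<close> into
      continuity in the last two arguments, as the derivative along a line requires.\<close>
    have "continuous_on UNIV (\<lambda>q. (t, q) :: real \<times> real \<times> real)"
      by (intro continuous_intros)
    from continuous_on_compose2[OF cont_z this] t
    have "continuous_on UNIV (\<lambda>(y, z). L_z t y z)" by (auto simp: case_prod_unfold image_subset_iff)
    from has_real_derivative_along_line[of "L t" "L_y t" "L_z t", OF deriv_y deriv_z this] t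
    show "((\<lambda>e. L t (f t + e * u t) (Df t + e * Du t)) has_real_derivative G e t) (at e within UNIV)"
      by (simp add: G_def)
  next
    show "(\<lambda>t. L t (f t + e * u t) (Df t + e * Du t)) integrable_on cbox 0 b" for e
      by (rule integrable_eq[OF int[of e, folded cbox_interval]]) (simp add: L_eq)
  qed auto
  moreover have "action_functional B \<alpha> b L (\<lambda>x. f x + e * u x)
      = integral (cbox 0 b) (\<lambda>t. L t (f t + e * u t) (Df t + e * Du t))" for e
    unfolding action_functional_def cbox_interval by (intro integral_cong L_eq)
  ultimately show ?thesis
    by (simp add: G_def[abs_def] Df_def Du_def lagrangian_along_def)
qed

text \<open>Since \<open>u\<close> is bounded on \<open>{0..b}\<close>, small \<open>e\<close> keep
  the variation within the sup-norm ball of the extremum. So \<open>e = 0\<close> is a local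
  extremum of a real function and its derivative there vanishes.\<close>

lemma local_extremum_variation_eq_0:
  assumes ext: "local_extremum_in b (admissible b A C) J f" and "0 < b"
    and adm: "\<And>e. (\<lambda>x. f x + e * u x) \<in> admissible b A C"
    and u: "continuous_on {0..b} u"
    and deriv: "((\<lambda>e. J (\<lambda>x. f x + e * u x)) has_real_derivative D) (at 0)"
  shows "D = 0"
proof -
  \<comment> \<open>The bound is taken positive, also for \<open>u = 0\<close>, so that
    \<open>\<epsilon> / M\<close> is a valid radius.\<close>
  obtain M where M: "\<And>t. t \<in> {0..b} \<Longrightarrow> \<bar>u t\<bar> \<le> M" "0 < M"
    using compact_imp_bounded[OF compact_continuous_image[OF u]]
    unfolding bounded_pos by (metis compact_Icc imageI real_norm_def)
  have close: "(SUP t\<in>{0..b}. \<bar>(f t + e * u t) - f t\<bar>) < \<epsilon>" if "\<bar>e\<bar> < \<epsilon> / M" for e \<epsilon>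
  proof -
    have "(SUP t\<in>{0..b}. \<bar>(f t + e * u t) - f t\<bar>) \<le> \<bar>e\<bar> * M"
      using M assms(2) by (intro cSUP_least) (auto simp: abs_mult intro!: mult_left_mono)
    also have "\<dots> < \<epsilon>" using that M(2) by (simp add: field_simps)
    finally show ?thesis .
  qed
  consider "local_max_in b (admissible b A C) J f" | "local_min_in b (admissible b A C) J f"
    using ext unfolding local_extremum_in_def by blast
  then show ?thesis
  proof cases
    case 1
    then obtain \<epsilon> where "0 < \<epsilon>" and "\<And>g. g \<in> admissible b A C \<Longrightarrow>
        (SUP t\<in>{0..b}. \<bar>g t - f t\<bar>) < \<epsilon> \<Longrightarrow> J g \<le> J f"
      unfolding local_max_in_def by blast
    then show ?thesis
      using M(2) adm close by (intro DERIV_local_max[OF deriv, of "\<epsilon> / M"]) auto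
  next
    case 2
    then obtain \<epsilon> where "0 < \<epsilon>" and "\<And>g. g \<in> admissible b A C \<Longrightarrow>
        (SUP t\<in>{0..b}. \<bar>g t - f t\<bar>) < \<epsilon> \<Longrightarrow> J g \<ge> J f"
      unfolding local_min_in_def by blast
    then show ?thesis
      using M(2) adm close by (intro DERIV_local_min[OF deriv, of "\<epsilon> / M"]) auto
  qed
qed

section \<open>The Euler-Lagrange equation\<close>

text \<open>Differentiability of the ABR integral belongs to the conclusion, since
  \<open>ABR_left\<close> has its intended meaning only then. \<open>J_defined\<close> says that the
  action is defined on all of \<open>C2_on b\<close>.\<close>

theorem theorem3p2:
  fixes B :: "real \<Rightarrow> real" and \<alpha> b A C :: real
    and L L_y L_z :: "real \<Rightarrow> real \<Rightarrow> real \<Rightarrow> real"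
    and f :: "real \<Rightarrow> real"
  assumes "0 < \<alpha>" and "\<alpha> < 1" and "0 < B \<alpha>" and "0 < b"
    and deriv_y: "\<And>t y z. t \<in> {0..b} \<Longrightarrow> ((\<lambda>u. L t u z) has_real_derivative L_y t y z) (at y)"
    and deriv_z: "\<And>t y z. t \<in> {0..b} \<Longrightarrow> ((\<lambda>u. L t y u) has_real_derivative L_z t y z) (at z)"
    and cont_y: "continuous_on ({0..b} \<times> UNIV) (\<lambda>(t, y, z). L_y t y z)"
    and cont_z: "continuous_on ({0..b} \<times> UNIV) (\<lambda>(t, y, z). L_z t y z)"
    and J_defined: "\<And>g. g \<in> C2_on b \<Longrightarrow> lagrangian_along B \<alpha> b L g integrable_on {0..b}"
    and f_adm: "f \<in> admissible b A C"
    and extremum: "local_extremum_in b (admissible b A C) (action_functional B \<alpha> b L) f"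
  shows "\<forall>s\<in>{0..b}.
    ABR_integral \<alpha> (lagrangian_along B \<alpha> b L_z f) differentiable (at s within {0..b}) \<and>
    lagrangian_along B \<alpha> b L_y f s + ABR_left B \<alpha> b (lagrangian_along B \<alpha> b L_z f) s = 0"
proof -
  define c where "c = B \<alpha> / (1 - \<alpha>)"
  have c: "0 < c" using assms(2,3) by (simp add: c_def)
  define p where "p = lagrangian_along B \<alpha> b L_y f"
  define q where "q = lagrangian_along B \<alpha> b L_z f"
  define G where "G = ABR_integral \<alpha> q"
  define P where "P x = integral {0..x} p" for x
  have fC2: "f \<in> C2_on b" and f0: "f 0 = A" "f b = C" using f_adm by (auto simp: admissible_def)
  obtain f' where f: "\<And>x. x \<in> {0..b} \<Longrightarrow> (f has_real_derivative f' x) (at x within {0..b})"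
    and f': "continuous_on {0..b} f'"
    using C2_on_D[OF fC2] by blast
  have cf: "continuous_on {0..b} f" by (rule DERIV_continuous_on[OF f])
  note cDf = continuous_on_ABC_right[OF assms(1,4) f f']
  have p: "continuous_on {0..b} p" and q: "continuous_on {0..b} q"
    unfolding p_def q_def
    by (intro continuous_on_lagrangian_along cont_y cont_z cf cDf; assumption)+
  have G: "continuous_on {0..b} G" unfolding G_def by (rule continuous_on_ABR_integral[OF assms(1) q])
  have P: "(P has_real_derivative p x) (at x within {0..b})" if "x \<in> {0..b}" for x
    unfolding P_def using integral_has_real_derivative[OF p that] .
  have cP: "continuous_on {0..b} P" by (rule DERIV_continuous_on[OF P])
  have cont: "continuous_on {0..b} (\<lambda>x. P x + c * G x)"
    by (intro continuous_intros cP G)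
  have orth: "integral {0..b} (\<lambda>x. u' x * (P x + c * G x)) = 0"
    if u1: "\<And>x. (u has_real_derivative u' x) (at x)"
      and u2: "\<And>x. (u' has_real_derivative u'' x) (at x)"
      and u3: "continuous_on UNIV u''" and u0: "u 0 = 0" "u b = 0" for u u' u''
  proof -
    have u: "(u has_real_derivative u' x) (at x within {0..b})" for x
      using u1 by (rule has_field_derivative_at_within)
    have cu: "continuous_on S u" and u': "continuous_on S u'" for S
      using u1 u2 by (meson DERIV_isCont continuous_at_imp_continuous_on)+
    have C2: "(\<lambda>x. f x + e * u x) \<in> C2_on b" for e
      by (rule C2_on_add_scale[OF fC2 u1 u2 u3])
    have adm: "(\<lambda>x. f x + e * u x) \<in> admissible b A C" for e
      using C2 f0 u0 by (simp add: admissible_def)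
    have "integral {0..b} (\<lambda>t. p t * u t + q t * ABC_right B \<alpha> b u t) = 0"
      unfolding p_def q_def
      by (rule local_extremum_variation_eq_0[OF extremum assms(4) adm cu
            has_real_derivative_action_functional[OF assms(1,4) deriv_y deriv_z cont_y cont_z f f' u u'
              J_defined[OF C2]]])
    moreover have "integral {0..b} (\<lambda>t. p t * u t + q t * ABC_right B \<alpha> b u t)
        = integral {0..b} (\<lambda>t. p t * u t) + integral {0..b} (\<lambda>t. q t * ABC_right B \<alpha> b u t)"
      by (intro integral_add integrable_continuous_real continuous_intros p q cu
          continuous_on_ABC_right[OF assms(1,4) u u'])
    moreover have "integral {0..b} (\<lambda>t. q t * ABC_right B \<alpha> b u t) = - c * integral {0..b} (\<lambda>x. u' x * G x)"
      unfolding c_def G_def by (rule ABC_right_adjoint[OF assms(1,4) u u' q])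
    \<comment> \<open>The integrated terms vanish with \<open>u\<close> at both ends. The derivative
      goes from \<open>P\<close> to \<open>u\<close>, so that both parts of the variation become
      integrals against \<open>u'\<close>.\<close>
    moreover have "integral {0..b} (\<lambda>t. p t * u t) = - integral {0..b} (\<lambda>x. P x * u' x)"
      using integral_by_parts_Icc[of 0 b P p u u'] assms(4) P u p u' u0 by simp
    moreover have "integral {0..b} (\<lambda>x. u' x * (P x + c * G x))
        = integral {0..b} (\<lambda>x. P x * u' x) + c * integral {0..b} (\<lambda>x. u' x * G x)"
    proof -
      have "integral {0..b} (\<lambda>x. u' x * (P x + c * G x))
          = integral {0..b} (\<lambda>x. P x * u' x + c * (u' x * G x))"
        by (simp add: algebra_simps)
      also have "\<dots> = integral {0..b} (\<lambda>x. P x * u' x) + integral {0..b} (\<lambda>x. c * (u' x * G x))"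
        by (intro integral_add integrable_continuous_real continuous_intros cP G u')
      finally show ?thesis by simp
    qed
    ultimately show ?thesis by simp
  qed
  have "(\<lambda>x. P x + c * G x) constant_on {0..b}"
    by (rule du_Bois_Reymond[OF assms(4) cont]) (rule orth)
  then obtain m where m: "\<And>x. x \<in> {0..b} \<Longrightarrow> P x + c * G x = m"
    unfolding constant_on_def by blast
  show ?thesis
  proof
    fix s assume s: "s \<in> {0..b}"
    \<comment> \<open>Solving \<open>P x + c * G x = m\<close> for \<open>G\<close> transfers the
      differentiability of \<open>P\<close> to \<open>G\<close>, one-sidedly at 0 and
      \<open>b\<close>.\<close>
    have "((\<lambda>x. (m - P x) / c) has_real_derivative (0 - p s) / c) (at s within {0..b})"
      by (intro DERIV_cdivide DERIV_diff DERIV_const P s)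
    moreover have "(m - P x) / c = G x" if "x \<in> {0..b}" for x
      using c by (simp flip: m[OF that])
    \<comment> \<open>The two functions agree on all of \<open>{0..b}\<close>, so the radius in the
      transfer is arbitrary and 1 is taken.\<close>
    ultimately have "(G has_real_derivative (0 - p s) / c) (at s within {0..b})"
      by (rule has_field_derivative_transform_within[OF _ zero_less_one s])
    then have vd: "(G has_vector_derivative - p s / c) (at s within {0..b})"
      by (simp add: has_real_derivative_iff_has_vector_derivative)
    then have "vector_derivative G (at s within {0..b}) = - p s / c"
      by (rule vector_derivative_within_closed_interval[OF assms(4) s])
    \<comment> \<open>The prefactor of \<open>ABR_left\<close> is exactly \<open>c\<close> and
      cancels the division by \<open>c\<close>.\<close>
    then have "p s + ABR_left B \<alpha> b q s = 0"
      using c by (simp add: ABR_left_def flip: G_def c_def)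
    moreover have "G differentiable (at s within {0..b})"
      using vd by (rule differentiableI_vector)
    ultimately show "ABR_integral \<alpha> (lagrangian_along B \<alpha> b L_z f) differentiable (at s within {0..b}) \<and>
        lagrangian_along B \<alpha> b L_y f s + ABR_left B \<alpha> b (lagrangian_along B \<alpha> b L_z f) s = 0"
      unfolding G_def p_def q_def by blast
  qed
qed

end
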